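(* Let $\eta$ be a finite Borel measure on $[0,1)$. For every $a$ in $[0,1)$, $$\beta_\eta(a)=2(1-a^2)^2F_\eta(1)+4a^2(1-a^2)^2\int_0^1\varkappa_\eta(r)\,\frac{(2+a^2r^2)(1-r^2)\,r}{(1-a^2r^2)^4}\,\mathrm{d}r.$$
   Context: Measures are positive. For a finite Borel measure $\eta$ on $[0,1)$, extended by zero to $\mathbb{R}$: $F_\eta(u)=\eta((-\infty,u])$, so $F_\eta(1)=\eta([0,1))$; $\varkappa_\eta(r)=\frac{2\,\eta([r,1))}{1-r^2}$ for $r\in[0,1)$; and $\beta_\eta(a)=2(1-a^2)^2\int_{[0,1)}\frac{1+a^2r^2}{(1-a^2r^2)^3}\,\mathrm{d}\eta(r)$ for $a\in[0,1)$. *)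

theory Defs
  imports "HOL-Analysis.Analysis"
begin

(* A Borel measure on [0,1) is a measure whose sigma-algebra is that of
   restrict_space borel {0..<1}; its space is then {0..<1}. *)

(* The extension by zero to the real line is the pushforward along the inclusion. *)
definition zero_ext :: "real measure \<Rightarrow> real measure" where
  "zero_ext \<eta> = distr \<eta> borel (\<lambda>x. x)"

definition F :: "real measure \<Rightarrow> real \<Rightarrow> real" where
  "F \<eta> u = measure (zero_ext \<eta>) {..u}"

(* Only the values at r in [0,1) are meaningful. *)
definition varkappa :: "real measure \<Rightarrow> real \<Rightarrow> real" where
  "varkappa \<eta> r = 2 * measure \<eta> {r..<1} / (1 - r^2)"

(* Only the values at a in [0,1) are meaningful. The integral is over the space {0..<1} of \<eta>. *)
definition \<beta> :: "real measure \<Rightarrow> real \<Rightarrow> real" where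
  "\<beta> \<eta> a = 2 * (1 - a^2)^2 * (LINT r|\<eta>. (1 + a^2 * r^2) / (1 - a^2 * r^2)^3)"

lemma F_1:
  assumes "sets \<eta> = sets (restrict_space borel {0..<1})"
  shows "F \<eta> 1 = measure \<eta> {0..<1}"
proof -
  have sp: "space \<eta> = {0..<1}"
    using sets_eq_imp_space_eq[OF assms] by (simp add: space_restrict_space)
  have "(\<lambda>x. x) \<in> measurable \<eta> (borel :: real measure)"
    unfolding measurable_cong_sets[OF assms refl] by (rule measurable_restrict_space1) simp
  then have "F \<eta> 1 = measure \<eta> ({..1} \<inter> space \<eta>)"
    unfolding F_def zero_ext_def by (subst measure_distr) auto
  also have "{..1} \<inter> space \<eta> = {0..<1}"
    using sp by auto
  finally show ?thesis .
qed

end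

theory Submission
  imports Defs
begin

text \<open>
  Writing \<open>h(s) - h(0)\<close> as the integral of \<open>h'\<close> over \<open>[0,s]\<close> and exchanging the two integrals
  turns the \<open>\<eta>\<close>-integral of \<open>h\<close> into one of \<open>h'\<close> against the tail \<open>\<eta>([r,1))\<close>. This is applied to
  \<open>h(r) = (1 + a\<^sup>2 r\<^sup>2) / (1 - a\<^sup>2 r\<^sup>2)\<^sup>3\<close>, whose derivative is
  \<open>4 a\<^sup>2 r (2 + a\<^sup>2 r\<^sup>2) / (1 - a\<^sup>2 r\<^sup>2)\<^sup>4\<close>.
\<close>

lemma integral_eq_tail_integral:
  fixes \<eta> :: "real measure" and h h' :: "real \<Rightarrow> real"
  assumes fin: "finite_measure \<eta>"
    and sets: "sets \<eta> = sets (restrict_space borel {0..<1})"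
    and deriv: "\<And>x. x \<in> {0..1} \<Longrightarrow> (h has_real_derivative h' x) (at x within {0..1})"
    and cont: "continuous_on {0..1} h'"
  shows "(LINT s|\<eta>. h s) = h 0 * measure \<eta> {0..<1} + (LBINT r=0..1. measure \<eta> {r..<1} * h' r)"
proof -
  interpret finite_measure \<eta> by (rule fin)
  have sp: "space \<eta> = {0..<1}"
    using sets_eq_imp_space_eq[OF sets] by (simp add: space_restrict_space)
  \<comment> \<open>Restricting Lebesgue measure to [0,1] keeps both factors of the product finite,
    and \<open>h'\<close>, whose continuity is assumed only there, becomes measurable.\<close>
  define N where "N = restrict_space lborel {0..1::real}"
  have spN: "space N = {0..1}" by (simp add: N_def space_restrict_space)
  have setsN: "sets N = sets (restrict_space borel {0..1})"
    by (simp add: N_def sets_restrict_space)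
  have finN: "finite_measure N"
    by (rule finite_measureI) (simp add: spN, simp add: N_def emeasure_restrict_space)
  interpret N: finite_measure N by (rule finN)
  interpret P: pair_sigma_finite \<eta> N ..
  interpret PF: finite_measure "\<eta> \<Otimes>\<^sub>M N"
    by (rule finite_measure_pair_measure[OF finN fin])
  have id_eta [measurable]: "(\<lambda>x. x) \<in> borel_measurable \<eta>"
    unfolding measurable_cong_sets[OF sets refl] by (rule measurable_restrict_space1) simp
  have id_N [measurable]: "(\<lambda>x. x) \<in> borel_measurable N"
    unfolding measurable_cong_sets[OF setsN refl] by (rule measurable_restrict_space1) simp
  have h'_N [measurable]: "h' \<in> borel_measurable N"
    unfolding measurable_cong_sets[OF setsN refl]
    by (rule borel_measurable_continuous_on_restrict[OF cont])
  have "continuous_on {0..1} h"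
    by (rule DERIV_continuous_on[OF deriv])
  then have cont_h: "continuous_on {0..<1} h"
    by (rule continuous_on_subset) auto
  \<comment> \<open>The kernel is \<open>h'\<close> cut to the triangle \<open>r \<le> s\<close>:
    integrated in \<open>r\<close> it gives \<open>h s - h 0\<close>, integrated in \<open>s\<close>
    the tail times \<open>h' r\<close>. The inequality is not strict, so an atom of
    \<open>\<eta>\<close> at \<open>r\<close> counts in the tail, as in
    \<open>{r..<1}\<close>.\<close>
  define f where "f s r = (if r \<le> s then h' r else 0)" for s r
  have f_meas: "case_prod f \<in> borel_measurable (\<eta> \<Otimes>\<^sub>M N)"
  proof -
    have "(\<lambda>z. fst z) \<in> borel_measurable (\<eta> \<Otimes>\<^sub>M N)" "(\<lambda>z. snd z) \<in> borel_measurable (\<eta> \<Otimes>\<^sub>M N)"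
      "(\<lambda>z. h' (snd z)) \<in> borel_measurable (\<eta> \<Otimes>\<^sub>M N)"
      using measurable_compose[OF measurable_fst id_eta] measurable_compose[OF measurable_snd id_N]
        measurable_compose[OF measurable_snd h'_N] by auto
    note [measurable] = this
    show ?thesis unfolding f_def case_prod_beta by measurable
  qed
  \<comment> \<open>By compactness \<open>h'\<close> is bounded on [0,1], which makes the kernel
    integrable over a finite product measure and so allows Fubini.\<close>
  obtain B where B: "\<And>x. x \<in> {0..1} \<Longrightarrow> norm (h' x) \<le> B"
    using compact_imp_bounded[OF compact_continuous_image[OF cont compact_Icc]]
    unfolding bounded_iff by fastforce
  have B0: "0 \<le> B" using B[of 0] norm_ge_zero[of "h' 0"] by auto
  have f_int: "integrable (\<eta> \<Otimes>\<^sub>M N) (case_prod f)"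
    by (rule PF.integrable_const_bound[OF _ f_meas, of B], rule AE_I2)
       (use B B0 in \<open>auto simp: f_def space_pair_measure spN\<close>)
  have inner_N: "(LINT r|N. f s r) = h s - h 0" if s: "s \<in> space \<eta>" for s
  proof -
    have s': "0 \<le> s" "s < 1" using s sp by auto
    have "(LINT r|N. f s r) = (LINT r:{0..1}|lborel. f s r)"
      unfolding N_def set_lebesgue_integral_def by (subst integral_restrict_space) auto
    also have "\<dots> = (LINT r:{0..s}|lborel. h' r)"
      unfolding set_lebesgue_integral_def f_def using s'
      by (intro Bochner_Integration.integral_cong) (auto simp: indicator_def)
    also have "\<dots> = (LBINT r=ereal 0..ereal s. h' r)"
      using s' by (simp add: interval_integral_Icc)
    also have "\<dots> = h s - h 0"
    proof (rule interval_integral_FTC_finite)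
      show "continuous_on {min 0 s..max 0 s} h'"
        using s' by (intro continuous_on_subset[OF cont]) auto
      show "(h has_vector_derivative h' x) (at x within {min 0 s..max 0 s})"
        if "min 0 s \<le> x" "x \<le> max 0 s" for x
        using s' that DERIV_subset[OF deriv, of x "{min 0 s..max 0 s}"]
        by (auto simp: has_real_derivative_iff_has_vector_derivative)
    qed
    finally show ?thesis .
  qed
  have inner_eta: "(LINT s|\<eta>. f s r) = measure \<eta> {r..<1} * h' r" if r: "r \<in> space N" for r
  proof -
    have "(LINT s|\<eta>. f s r) = (LINT s|\<eta>. indicator {r..<1} s * h' r)"
      by (intro Bochner_Integration.integral_cong) (auto simp: f_def sp)
    also have "\<dots> = measure \<eta> ({r..<1} \<inter> space \<eta>) * h' r" by simp
    also have "{r..<1} \<inter> space \<eta> = {r..<1}" using r by (auto simp: sp spN)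
    finally show ?thesis .
  qed
  have h_meas: "h \<in> borel_measurable \<eta>"
    unfolding measurable_cong_sets[OF sets refl]
    by (rule borel_measurable_continuous_on_restrict[OF cont_h])
  \<comment> \<open>Fubini also yields integrability of the inner integral of the kernel, which is
    \<open>h s - h 0\<close> on the space of \<open>\<eta>\<close>.\<close>
  have diff_int: "integrable \<eta> (\<lambda>s. h s - h 0)"
    using P.integrable_fst'[OF f_int]
    by (rule Bochner_Integration.integrable_cong[THEN iffD1, OF refl, rotated]) (simp add: inner_N)
  have "(LINT s|\<eta>. h s) = (LINT s|\<eta>. h 0 + (h s - h 0))" by simp
  also have "\<dots> = h 0 * measure \<eta> {0..<1} + (LINT s|\<eta>. h s - h 0)"
    by (subst Bochner_Integration.integral_add[OF _ diff_int]) (auto simp: sp)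
  also have "(LINT s|\<eta>. h s - h 0) = (LINT s|\<eta>. LINT r|N. f s r)"
    by (intro Bochner_Integration.integral_cong) (simp_all add: inner_N)
  also have "\<dots> = (LINT r|N. LINT s|\<eta>. f s r)"
    by (rule P.Fubini_integral[OF f_int, symmetric])
  also have "\<dots> = (LINT r|N. measure \<eta> {r..<1} * h' r)"
    by (intro Bochner_Integration.integral_cong) (simp_all add: inner_eta)
  also have "\<dots> = (LINT r:{0..1}|lborel. measure \<eta> {r..<1} * h' r)"
    unfolding N_def set_lebesgue_integral_def by (subst integral_restrict_space) auto
  also have "\<dots> = (LBINT r=ereal 0..ereal 1. measure \<eta> {r..<1} * h' r)"
    by (simp add: interval_integral_Icc)
  finally show ?thesis by (simp add: zero_ereal_def one_ereal_def)
qed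

theorem proposition5p7:
  fixes \<eta> :: "real measure" and a :: real
  assumes "finite_measure \<eta>"
    and "sets \<eta> = sets (restrict_space borel {0..<1})"
    and "a \<in> {0..<1}"
  shows "\<beta> \<eta> a = 2 * (1 - a^2)^2 * F \<eta> 1
    + 4 * a^2 * (1 - a^2)^2 *
      (LBINT r=0..1. varkappa \<eta> r * ((2 + a^2 * r^2) * (1 - r^2) * r / (1 - a^2 * r^2)^4))"
proof -
  define h where "h r = (1 + a^2 * r^2) / (1 - a^2 * r^2)^3" for r
  \<comment> \<open>This is the kernel of the claim without the factor \<open>1 - r^2\<close>, which
    will cancel the denominator of \<open>varkappa\<close>.\<close>
  define k where "k r = (2 + a^2 * r^2) * r / (1 - a^2 * r^2)^4" for r
  \<comment> \<open>Since \<open>a < 1\<close>, the denominators stay positive up to and including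
    \<open>r = 1\<close>, so \<open>h\<close> is differentiable on the closed interval.\<close>
  have pos: "1 - a^2 * r^2 > 0" if "r \<in> {0..1}" for r
  proof -
    have "a^2 * r^2 \<le> a^2 * 1"
      using that by (intro mult_left_mono) (auto simp: power_le_one)
    also have "\<dots> < 1" using assms(3) by (simp add: abs_square_less_1)
    finally show ?thesis by simp
  qed
  have deriv: "(h has_real_derivative 4 * a^2 * k r) (at r within {0..1})" if "r \<in> {0..1}" for r
  proof -
    \<comment> \<open>In terms of \<open>d\<close> the numerator from the quotient rule is
      \<open>2 * a^2 * r * d^2 * (d + 3 * (2 - d))\<close>, that is
      \<open>4 * a^2 * r * d^2 * (3 - d)\<close>, and \<open>3 - d = 2 + a^2 * r^2\<close>.\<close>
    define d where "d = 1 - a^2 * r^2"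
    have d: "d \<noteq> 0" using pos[OF that] by (simp add: d_def)
    have ar: "a^2 * r^2 = 1 - d" by (simp add: d_def)
    have "(h has_real_derivative
        (2 * a^2 * r * d^3 + (1 + (1 - d)) * (3 * d^2 * (2 * a^2 * r))) / (d^3 * d^3)) (at r within {0..1})"
      unfolding h_def
      by (rule derivative_eq_intros refl | use d in \<open>simp add: ar\<close>)+
    also have "(2 * a^2 * r * d^3 + (1 + (1 - d)) * (3 * d^2 * (2 * a^2 * r))) / (d^3 * d^3) = 4 * a^2 * k r"
      unfolding k_def ar using d
      by (simp add: divide_simps) algebra
    finally show ?thesis .
  qed
  have cont: "continuous_on {0..1} (\<lambda>r. 4 * a^2 * k r)"
    unfolding k_def by (intro continuous_intros) (use pos in force)
  \<comment> \<open>The boundary term is the total mass because \<open>h 0 = 1\<close>.\<close>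
  have "(LINT s|\<eta>. h s) = F \<eta> 1 + (LBINT r=0..1. measure \<eta> {r..<1} * (4 * a^2 * k r))"
    using integral_eq_tail_integral[OF assms(1,2) deriv cont] F_1[OF assms(2)] by (simp add: h_def)
  also have "(LBINT r=0..1. measure \<eta> {r..<1} * (4 * a^2 * k r)) =
      (LBINT r=0..1. 2 * a^2 * (varkappa \<eta> r * ((2 + a^2 * r^2) * (1 - r^2) * r / (1 - a^2 * r^2)^4)))"
  proof (rule interval_integral_cong)
    \<comment> \<open>Only the open interval has to be compared, which excludes
      \<open>r = 1\<close>, where \<open>varkappa\<close> divides by zero.\<close>
    fix r :: real assume "r \<in> einterval (min 0 1) (max 0 1)"
    then have "0 < r" "r < 1" by (auto simp: einterval_def zero_ereal_def one_ereal_def min_def max_def)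
    then have "1 - r^2 \<noteq> 0" by (simp add: power2_eq_1_iff)
    then have "varkappa \<eta> r * (1 - r^2) = 2 * measure \<eta> {r..<1}"
      by (simp add: varkappa_def)
    then show "measure \<eta> {r..<1} * (4 * a^2 * k r) =
        2 * a^2 * (varkappa \<eta> r * ((2 + a^2 * r^2) * (1 - r^2) * r / (1 - a^2 * r^2)^4))"
      unfolding k_def by (simp add: divide_simps)
  qed
  finally show ?thesis
    unfolding \<beta>_def h_def interval_lebesgue_integral_mult_right by (simp only: algebra_simps)
qed

end
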